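(* Let $p_1\ge 1$ be an integer and let $\{\Theta_{j_1,j_2}\}_{-p_1\le j_1,j_2\le p_1}$ be real numbers with $\Theta_{j_1,j_2}=\Theta_{-j_1,-j_2}$. Let $F$ be the spectral density of the cepstral model, $$F(\lambda_1,\lambda_2)=\exp\Big\{\sum_{j_1=-p_1}^{p_1}\sum_{j_2=-p_1}^{p_1}\Theta_{j_1,j_2}Z_1^{j_1}Z_2^{j_2}\Big\},\qquad Z_j=e^{-i\lambda_j},\ (\lambda_1,\lambda_2)\in[-\pi,\pi]^2,$$ and let $\gamma_{h_1,h_2}(F)=\frac1{4\pi^2}\int_{-\pi}^{\pi}\int_{-\pi}^{\pi}F(\lambda_1,\lambda_2)Z_1^{-h_1}Z_2^{-h_2}\,d\lambda_1\,d\lambda_2$ be its autocovariance function. Then for all $h_1,h_2\in\mathbb Z$, $$\gamma_{h_1,h_2}(F)=e^{\Theta_{0,0}}\sum_{j_1,j_2\in\mathbb Z}\gamma_{j_1,j_2}(\Phi)\Big[\sum_{k_1,k_2\in\mathbb Z}\gamma_{h_1+j_1-k_1,\,h_2-j_2-k_2}(\Psi)\,\gamma_{k_1}(\Xi)\,\gamma_{k_2}(\Omega)\Big],$$ where $$\gamma_{s_1,s_2}(\Psi)=\sum_{k_1,k_2\ge0}\psi_{s_1+k_1,s_2+k_2}\psi_{k_1,k_2},\qquad \gamma_{s_1,s_2}(\Phi)=\sum_{k_1,k_2\ge0}\phi_{s_1+k_1,s_2+k_2}\phi_{k_1,k_2},$$ $$\gamma_{h}(\Xi)=\sum_{k\ge0}\xi_{k+h}\xi_k,\qquad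 \gamma_{h}(\Omega)=\sum_{k\ge0}\omega_{k+h}\omega_k,$$ and the coefficients are given recursively, for $j_1\ge1$ and $j_2\ge1$, by $$\psi_{j_1,j_2}=\frac1{j_1}\sum_{k_1=1}^{p_1}k_1\Big(\sum_{k_2=1}^{j_2}\psi_{j_1-k_1,j_2-k_2}\Theta_{k_1,k_2}\Big),\qquad \phi_{j_1,j_2}=\frac1{j_1}\sum_{k_1=1}^{p_1}k_1\Big(\sum_{k_2=1}^{j_2}\phi_{j_1-k_1,j_2-k_2}\Theta_{-k_1,k_2}\Big),$$ $$\xi_{j_1}=\frac1{j_1}\sum_{k_1=1}^{p_1}k_1\Theta_{k_1,0}\,\xi_{j_1-k_1},\qquad \omega_{j_2}=\frac1{j_2}\sum_{k_2=1}^{p_1}k_2\Theta_{0,k_2}\,\omega_{j_2-k_2},$$ with the initial values $\psi_{0,0}=\phi_{0,0}=\xi_0=\omega_0=1$ and $\psi_{j,0}=\psi_{0,j}=\phi_{j,0}=\phi_{0,j}=0$ for $j\ge1$.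
   Context: Conventions: $\Theta_{j_1,j_2}=0$ whenever $|j_1|>p_1$ or $|j_2|>p_1$; $\psi,\phi,\xi,\omega$ are zero whenever any of their indices is negative. The coefficients are those of the formal series $\Psi(B_1,B_2)=\sum_{j_1,j_2\ge0}\psi_{j_1,j_2}B_1^{j_1}B_2^{j_2}$ (the "causal field"), $\Phi(B_1,B_2)=\sum_{j_1,j_2\ge0}\phi_{j_1,j_2}B_1^{-j_1}B_2^{j_2}$ (the "skew field"), $\Xi(B_1)=\sum_{j_1\ge0}\xi_{j_1}B_1^{j_1}$ and $\Omega(B_2)=\sum_{j_2\ge0}\omega_{j_2}B_2^{j_2}$ ($B_1,B_2$ being backshift operators in the two coordinates), so that $|\Psi(Z_1,Z_2)|^2=\sum_{s_1,s_2\in\mathbb Z}\gamma_{s_1,s_2}(\Psi)Z_1^{s_1}Z_2^{s_2}$ and $|\Phi(Z_1,Z_2)|^2=\sum_{s_1,s_2\in\mathbb Z}\gamma_{s_1,s_2}(\Phi)Z_1^{-s_1}Z_2^{s_2}$. *)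

theory Defs
  imports "HOL-Analysis.Analysis"
begin

text \<open>Cepstral parameters are functions \<open>\<Theta> :: int \<Rightarrow> int \<Rightarrow> real\<close>. The exponent is a complex trigonometric
  polynomial, so the spectral density is complex-valued here; it is real and positive when
  \<open>\<Theta> j\<^sub>1 j\<^sub>2 = \<Theta> (- j\<^sub>1) (- j\<^sub>2)\<close>.\<close>

definition cepstral_density :: "nat \<Rightarrow> (int \<Rightarrow> int \<Rightarrow> real) \<Rightarrow> real \<Rightarrow> real \<Rightarrow> complex" where
  "cepstral_density p \<Theta> t1 t2 =
     exp (\<Sum>j1 = - int p..int p. \<Sum>j2 = - int p..int p.
            complex_of_real (\<Theta> j1 j2) * exp (- \<i> * t1) powi j1 * exp (- \<i> * t2) powi j2)"

definition spectral_acov :: "(real \<Rightarrow> real \<Rightarrow> complex) \<Rightarrow> int \<Rightarrow> int \<Rightarrow> complex" where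
  "spectral_acov F h1 h2 =
     1 / (4 * pi\<^sup>2) *
       integral {- pi..pi} (\<lambda>t2. integral {- pi..pi} (\<lambda>t1.
         F t1 t2 * exp (- \<i> * t1) powi (- h1) * exp (- \<i> * t2) powi (- h2)))"

text \<open>Coefficient arrays are indexed by integers and vanish at negative indices. The array \<open>\<phi>\<close> obeys
  the recursion of \<open>\<psi>\<close> with \<open>\<Theta> k\<^sub>1 k\<^sub>2\<close> replaced by \<open>\<Theta> (- k\<^sub>1) k\<^sub>2\<close>.\<close>

function psi_coeff :: "nat \<Rightarrow> (int \<Rightarrow> int \<Rightarrow> real) \<Rightarrow> int \<Rightarrow> int \<Rightarrow> real" where
  "psi_coeff p (\<Theta> :: int \<Rightarrow> int \<Rightarrow> real) j1 j2 =
     (if j1 < 0 \<or> j2 < 0 then 0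
      else if j1 = 0 \<and> j2 = 0 then 1
      else if j1 = 0 \<or> j2 = 0 then 0
      else 1 / real_of_int j1 * (\<Sum>k1 = 1..int p. real_of_int k1 *
             (\<Sum>k2 = 1..j2. psi_coeff p \<Theta> (j1 - k1) (j2 - k2) * \<Theta> k1 k2)))"
  by pat_completeness auto
termination
  by (relation "Wellfounded.measure (\<lambda>(p, \<Theta>, j1, j2). nat j1)") auto

declare psi_coeff.simps [simp del]

definition phi_coeff :: "nat \<Rightarrow> (int \<Rightarrow> int \<Rightarrow> real) \<Rightarrow> int \<Rightarrow> int \<Rightarrow> real" where
  "phi_coeff p \<Theta> = psi_coeff p (\<lambda>k1 k2. \<Theta> (- k1) k2)"

function axis_coeff :: "nat \<Rightarrow> (int \<Rightarrow> real) \<Rightarrow> int \<Rightarrow> real" where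
  "axis_coeff p (\<theta> :: int \<Rightarrow> real) j =
     (if j < 0 then 0
      else if j = 0 then 1
      else 1 / real_of_int j * (\<Sum>k = 1..int p. real_of_int k * \<theta> k * axis_coeff p \<theta> (j - k)))"
  by pat_completeness auto
termination
  by (relation "Wellfounded.measure (\<lambda>(p, \<theta>, j). nat j)") auto

declare axis_coeff.simps [simp del]

definition xi_coeff :: "nat \<Rightarrow> (int \<Rightarrow> int \<Rightarrow> real) \<Rightarrow> int \<Rightarrow> real" where
  "xi_coeff p \<Theta> = axis_coeff p (\<lambda>k. \<Theta> k 0)"

definition omega_coeff :: "nat \<Rightarrow> (int \<Rightarrow> int \<Rightarrow> real) \<Rightarrow> int \<Rightarrow> real" where
  "omega_coeff p \<Theta> = axis_coeff p (\<lambda>k. \<Theta> 0 k)"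

lemma phi_coeff_rec:
  assumes "1 \<le> j1" "1 \<le> j2"
  shows "phi_coeff p \<Theta> j1 j2 = 1 / real_of_int j1 * (\<Sum>k1 = 1..int p. real_of_int k1 *
           (\<Sum>k2 = 1..j2. phi_coeff p \<Theta> (j1 - k1) (j2 - k2) * \<Theta> (- k1) k2))"
  using assms unfolding phi_coeff_def by (subst psi_coeff.simps) auto

lemma xi_coeff_rec:
  assumes "1 \<le> j"
  shows "xi_coeff p \<Theta> j = 1 / real_of_int j * (\<Sum>k = 1..int p. real_of_int k * \<Theta> k 0 * xi_coeff p \<Theta> (j - k))"
  using assms unfolding xi_coeff_def by (subst axis_coeff.simps) auto

lemma omega_coeff_rec:
  assumes "1 \<le> j"
  shows "omega_coeff p \<Theta> j = 1 / real_of_int j * (\<Sum>k = 1..int p. real_of_int k * \<Theta> 0 k * omega_coeff p \<Theta> (j - k))"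
  using assms unfolding omega_coeff_def by (subst axis_coeff.simps) auto

text \<open>Since \<open>infsum\<close> is \<open>0\<close> for families that are not summable, convergence of the series defining
  the autocovariances of coefficient arrays is recorded by separate predicates.\<close>

definition acov2_converges :: "(int \<Rightarrow> int \<Rightarrow> real) \<Rightarrow> bool" where
  "acov2_converges c \<longleftrightarrow>
     (\<forall>s1 s2. (\<lambda>(k1, k2). c (s1 + k1) (s2 + k2) * c k1 k2) summable_on {0..} \<times> {0..})"

definition acov2 :: "(int \<Rightarrow> int \<Rightarrow> real) \<Rightarrow> int \<Rightarrow> int \<Rightarrow> real" where
  "acov2 c s1 s2 = (\<Sum>\<^sub>\<infinity>(k1, k2)\<in>{0..} \<times> {0..}. c (s1 + k1) (s2 + k2) * c k1 k2)"

definition acov1_converges :: "(int \<Rightarrow> real) \<Rightarrow> bool" where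
  "acov1_converges c \<longleftrightarrow> (\<forall>h. (\<lambda>k. c (k + h) * c k) summable_on {0..})"

definition acov1 :: "(int \<Rightarrow> real) \<Rightarrow> int \<Rightarrow> real" where
  "acov1 c h = (\<Sum>\<^sub>\<infinity>k\<in>{0..}. c (k + h) * c k)"

end

theory Submission
  imports Defs "HOL-Complex_Analysis.Complex_Analysis"
begin

text \<open>For unimodular \<open>u = e\<^bsup>-it\<^sub>1\<^esup>\<close>, \<open>v = e\<^bsup>-it\<^sub>2\<^esup>\<close> the symmetry of \<open>\<Theta>\<close> splits the exponent into its value at
  the origin and four polynomials plus their conjugates, one for each of the open quadrants
  \<open>j\<^sub>1, j\<^sub>2 > 0\<close> and \<open>j\<^sub>1 < 0 < j\<^sub>2\<close> and the two positive half-axes. Hence the density is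
  \<open>exp \<Theta>\<^sub>0\<^sub>0 \<bar>\<Psi>\<bar>\<^sup>2 \<bar>\<Phi>\<bar>\<^sup>2 \<bar>\<Xi>\<bar>\<^sup>2 \<bar>\<Omega>\<bar>\<^sup>2\<close>, where each factor is the exponential of a polynomial; logarithmic
  differentiation yields the recursions for its coefficients, which are absolutely summable.
  Absolutely summable families form an algebra under convolution, a unitary character of the index
  group turns convolution into multiplication and reflection into conjugation, and so the
  density is the transform of the iterated convolution of the four autocovariance families.
  Integrating this uniformly convergent series term by term reads off its coefficients.\<close>

no_notation Infinite_Set_Sum.abs_summable_on (infix \<open>abs'_summable'_on\<close> 50)

subsection \<open>Exponentials of polynomials\<close>

text \<open>Comparing coefficients in \<open>z f'(z) = (\<Sum>k. k b\<^sub>k z\<^sup>k) f(z)\<close> for the entire function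
  \<open>f(z) = exp (\<Sum>k. b\<^sub>k z\<^sup>k)\<close> shows that its Taylor coefficients solve the recursion.\<close>

lemma exp_poly_recursion_sums:
  fixes a b :: "nat \<Rightarrow> complex"
  assumes a0: "a 0 = 1"
    and rec: "\<And>n. n \<ge> 1 \<Longrightarrow>
      of_nat n * a n = (\<Sum>k=1..p. of_nat k * b k * (if n < k then 0 else a (n - k)))"
  shows "(\<lambda>n. a n * z ^ n) sums exp (\<Sum>k=1..p. b k * z ^ k)"
proof -
  define f where "f = (\<lambda>z. exp (\<Sum>k=1..p. b k * z ^ k))"
  define E where "E = fps_expansion f 0"
  have holo: "f holomorphic_on A" for A
    unfolding f_def by (intro holomorphic_intros)
  have f: "f has_fps_expansion E"
    unfolding E_def using holo[of UNIV] by blast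
  have "deriv f z = (\<Sum>k=1..p. b k * (of_nat k * z ^ (k - 1))) * f z" for z
    unfolding f_def by (rule DERIV_imp_deriv) (auto intro!: derivative_eq_intros simp: mult_ac)
  then have D: "(\<lambda>z. z * deriv f z) = (\<lambda>z. (\<Sum>k=1..p. (of_nat k * b k) * z ^ k) * f z)"
    by (auto simp: fun_eq_iff sum_distrib_left sum_distrib_right power_eq_if mult_ac intro!: sum.cong)
  define B where "B = (\<Sum>k=1..p. fps_const (of_nat k * b k) * fps_X ^ k)"
  have "(\<lambda>z. z * deriv f z) has_fps_expansion fps_X * fps_deriv E"
    by (intro fps_expansion_intros f)
  moreover have "(\<lambda>z. (\<Sum>k=1..p. (of_nat k * b k) * z ^ k) * f z) has_fps_expansion B * E"
    unfolding B_def by (intro fps_expansion_intros f)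
  ultimately have eq: "fps_X * fps_deriv E = B * E"
    unfolding D using fps_expansion_unique_complex by blast
  have E: "of_nat n * fps_nth E n
      = (\<Sum>k=1..p. of_nat k * b k * (if n < k then 0 else fps_nth E (n - k)))" for n
  proof -
    \<comment> \<open>The factor \<open>fps_X\<close> undoes the index shift of the derivative, so
      both sides carry index \<open>n\<close>; at \<open>n = 0\<close> both vanish.\<close>
    have "of_nat n * fps_nth E n = fps_nth (fps_X * fps_deriv E) n"
      by (cases n) auto
    also have "\<dots> = (\<Sum>k=1..p. fps_nth (fps_const (of_nat k * b k) * (fps_X ^ k * E)) n)"
      unfolding eq B_def by (simp add: sum_distrib_right fps_sum_nth mult.assoc)
    also have "\<dots> = (\<Sum>k=1..p. of_nat k * b k * (if n < k then 0 else fps_nth E (n - k)))"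
      by (simp only: fps_mult_left_const_nth fps_X_power_mult_nth)
    finally show ?thesis .
  qed
  \<comment> \<open>As \<open>k\<close> starts at 1, the recursion at \<open>n\<close> refers to
    smaller indices only, and for \<open>n > 0\<close> it determines the coefficient after division
    by \<open>n\<close>.\<close>
  have "a n = fps_nth E n" for n
  proof (induction n rule: less_induct)
    case (less n)
    show ?case
    proof (cases "n = 0")
      case True
      then show ?thesis
        using a0 has_fps_expansion_imp_0_eq_fps_nth_0[OF f] by (simp add: f_def power_0_left)
    next
      case False
      then have "of_nat n * a n = (\<Sum>k=1..p. of_nat k * b k * (if n < k then 0 else a (n - k)))"
        by (intro rec) simp
      also have "\<dots> = of_nat n * fps_nth E n"
        unfolding E using less False by (intro sum.cong) auto
      finally have "of_nat n * a n = of_nat n * fps_nth E n" .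
      then show ?thesis using False by simp
    qed
  qed
  moreover have "(\<lambda>n. fps_nth E n * z ^ n) sums f z"
  proof -
    \<comment> \<open>\<open>f\<close> is entire, so any disc about 0 containing \<open>z\<close>
      serves; radius \<open>norm z + 1\<close> is one.\<close>
    have "(\<lambda>n. (deriv ^^ n) f 0 / fact n * (z - 0) ^ n) sums f z"
      by (rule holomorphic_power_series[where r = "norm z + 1"]) (use holo in auto)
    then show ?thesis by (simp add: E_def fps_expansion_def)
  qed
  ultimately show ?thesis by (simp add: f_def)
qed

lemma has_sum_nonneg_int:
  fixes f :: "int \<Rightarrow> 'b :: {comm_monoid_add, topological_space}"
  assumes "\<And>j. j < 0 \<Longrightarrow> f j = 0"
  shows "(f has_sum S) UNIV \<longleftrightarrow> ((\<lambda>n. f (int n)) has_sum S) UNIV"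
proof -
  have "(f has_sum S) UNIV \<longleftrightarrow> (f has_sum S) {0..}"
    by (rule has_sum_cong_neutral) (use assms in auto)
  also have "\<dots> \<longleftrightarrow> ((\<lambda>n. f (int n)) has_sum S) UNIV"
    by (rule has_sum_reindex_bij_betw [symmetric])
      (auto simp: bij_betw_def inj_on_def image_def dest: zero_le_imp_eq_int)
  finally show ?thesis .
qed

text \<open>Integer-indexed form with unordered summation. The zero convention at negative indices
  replaces the case distinction \<open>n < k\<close>.\<close>

lemma exp_poly_recursion_has_sum:
  fixes a b :: "int \<Rightarrow> complex"
  assumes a0: "a 0 = 1" and neg: "\<And>j. j < 0 \<Longrightarrow> a j = 0"
    and rec: "\<And>j. j \<ge> 1 \<Longrightarrow> of_int j * a j = (\<Sum>k=1..int p. of_int k * b k * a (j - k))"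
  shows "((\<lambda>j. a j * z powi j) has_sum exp (\<Sum>k=1..int p. b k * z powi k)) UNIV"
proof -
  have sum_int: "(\<Sum>k=1..int p. g k) = (\<Sum>k=1..p. g (int k))" for g :: "int \<Rightarrow> complex"
    by (rule sum.reindex_bij_witness[of _ int nat]) auto
  have sums: "(\<lambda>n. a (int n) * z ^ n) sums exp (\<Sum>k=1..p. b (int k) * z ^ k)" for z
  proof (rule exp_poly_recursion_sums)
    fix n :: nat assume "n \<ge> 1"
    then have "of_nat n * a (int n) = (\<Sum>k=1..p. of_nat k * b (int k) * a (int n - int k))"
      using rec[of "int n"] by (simp add: sum_int)
    also have "\<dots> = (\<Sum>k=1..p. of_nat k * b (int k) * (if n < k then 0 else a (int (n - k))))"
      by (intro sum.cong) (auto simp: neg of_nat_diff)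
    finally show "of_nat n * a (int n) = \<dots>" .
  qed (simp add: a0)
  \<comment> \<open>Convergence at the point \<open>norm z + 1\<close>, of larger modulus than
    \<open>z\<close>, forces absolute convergence at \<open>z\<close>.\<close>
  have "summable (\<lambda>n. norm (a (int n) * z ^ n))"
    by (rule powser_insidea[OF sums_summable[OF sums, of "of_real (norm z + 1)"]]) simp
  from norm_summable_imp_has_sum[OF this sums]
  have "((\<lambda>n. a (int n) * z powi int n) has_sum exp (\<Sum>k=1..int p. b k * z powi k)) UNIV"
    by (simp add: sum_int power_int_def)
  then show ?thesis
    by (subst has_sum_nonneg_int) (auto simp: neg)
qed

subsection \<open>Absolutely summable families and unitary characters\<close>

lemma bij_betw_diff_pair:
  "bij_betw (\<lambda>(h, k). (h - k, k)) UNIV (UNIV :: ('a::ab_group_add \<times> 'a) set)"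
  by (rule bij_betwI[where g = "\<lambda>(i, k). (i + k, k)"]) auto

lemma
  fixes f :: "'i \<Rightarrow> 'b::{banach, real_normed_field}" and g :: "'j \<Rightarrow> 'b"
  assumes f: "f abs_summable_on UNIV" and g: "g abs_summable_on UNIV"
  shows abs_summable_tensor: "(\<lambda>(i, k). f i * g k) abs_summable_on UNIV"
    and infsum_tensor: "(\<Sum>\<^sub>\<infinity>(i, k). f i * g k) = infsum f UNIV * infsum g UNIV"
proof -
  have "(\<lambda>(i, k). f i * g k) abs_summable_on UNIV \<times> UNIV"
    unfolding Infinite_Sum.abs_summable_on_Sigma_iff
    using f g by (auto simp: norm_mult abs_mult infsum_cmult_right' intro!: summable_on_cmult_right summable_on_cmult_left)
  then show *: "(\<lambda>(i, k). f i * g k) abs_summable_on UNIV"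
    by simp
  have "(\<Sum>\<^sub>\<infinity>(i, k). f i * g k) = (\<Sum>\<^sub>\<infinity>i. \<Sum>\<^sub>\<infinity>k. f i * g k)"
    using infsum_Sigma_banach[of "\<lambda>(i, k). f i * g k" UNIV "\<lambda>_. UNIV"] abs_summable_summable[OF *] by simp
  then show "(\<Sum>\<^sub>\<infinity>(i, k). f i * g k) = infsum f UNIV * infsum g UNIV"
    by (simp add: infsum_cmult_right' infsum_cmult_left')
qed

text \<open>The shear \<open>(h, k) \<mapsto> (h - k, k)\<close> is a bijection carrying the double
  family \<open>f (h - k) * g k\<close> to the product family \<open>f i * g k\<close>. Absolute
  summability is pulled back along it, and Fubini gives the rows and the total sum.\<close>

lemma
  fixes f g :: "'a::ab_group_add \<Rightarrow> 'b::{banach, real_normed_field}"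
  assumes f: "f abs_summable_on UNIV" and g: "g abs_summable_on UNIV"
  shows abs_summable_convolution_term: "(\<lambda>k. f (h - k) * g k) abs_summable_on UNIV"
    and abs_summable_convolution: "(\<lambda>h. \<Sum>\<^sub>\<infinity>k. f (h - k) * g k) abs_summable_on UNIV"
    and infsum_convolution:
      "(\<Sum>\<^sub>\<infinity>h. \<Sum>\<^sub>\<infinity>k. f (h - k) * g k) = infsum f UNIV * infsum g UNIV"
proof -
  define F where "F = (\<lambda>(i, k). f i * g k)"
  define G where "G = (\<lambda>(h, k). f (h - k) * g k)"
  have G: "G = (\<lambda>z. F ((\<lambda>(h, k). (h - k, k)) z))"
    by (auto simp: F_def G_def fun_eq_iff)
  have G_sum: "G abs_summable_on UNIV \<times> UNIV"
    unfolding G UNIV_Times_UNIV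
    using abs_summable_tensor[OF f g]
    by (subst summable_on_reindex_bij_betw[OF bij_betw_diff_pair, of "\<lambda>z. norm (F z)"]) (simp add: F_def)
  show terms: "(\<lambda>k. f (h - k) * g k) abs_summable_on UNIV" for h
    using G_sum unfolding Infinite_Sum.abs_summable_on_Sigma_iff by (simp add: G_def)
  have "(\<lambda>h. \<Sum>\<^sub>\<infinity>k. norm (G (h, k))) summable_on UNIV"
    using conjunct2[OF G_sum[unfolded Infinite_Sum.abs_summable_on_Sigma_iff]]
    by (rule abs_summable_summable)
  then show "(\<lambda>h. \<Sum>\<^sub>\<infinity>k. f (h - k) * g k) abs_summable_on UNIV"
    by (rule Infinite_Sum.abs_summable_on_comparison_test')
      (use norm_infsum_bound[OF terms] in \<open>simp add: G_def\<close>)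
  have "(\<Sum>\<^sub>\<infinity>h. \<Sum>\<^sub>\<infinity>k. f (h - k) * g k) = infsum G (UNIV \<times> UNIV)"
    using infsum_Sigma_banach[OF abs_summable_summable[OF G_sum]] by (simp add: G_def)
  also have "\<dots> = infsum F UNIV"
    unfolding G UNIV_Times_UNIV by (rule infsum_reindex_bij_betw[OF bij_betw_diff_pair])
  also have "\<dots> = infsum f UNIV * infsum g UNIV"
    unfolding F_def by (rule infsum_tensor[OF f g])
  finally show "(\<Sum>\<^sub>\<infinity>h. \<Sum>\<^sub>\<infinity>k. f (h - k) * g k) = infsum f UNIV * infsum g UNIV" .
qed

section \<open>Fourier transforms along unitary characters\<close>

definition transform :: "('a \<Rightarrow> complex) \<Rightarrow> ('a \<Rightarrow> real) \<Rightarrow> complex" where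
  "transform \<eta> c = (\<Sum>\<^sub>\<infinity>j. of_real (c j) * \<eta> j)"

text \<open>Homomorphisms into the unit circle. An abstract index group lets the same lemmas serve
  the axis fields over the integers and the planar fields over integer pairs.\<close>

locale unitary_character =
  fixes \<eta> :: "'a::ab_group_add \<Rightarrow> complex"
  assumes char_add: "\<eta> (i + j) = \<eta> i * \<eta> j"
    and norm_char [simp]: "norm (\<eta> i) = 1"
begin

lemma char_0: "\<eta> 0 = 1"
  using char_add[of 0 0] norm_char[of 0] by (metis add_0 mult_cancel_left2 norm_zero zero_neq_one)

lemma char_minus: "\<eta> (- i) = cnj (\<eta> i)"
proof -
  have "\<eta> i * \<eta> (- i) = \<eta> i * cnj (\<eta> i)"
    using char_add[of i "- i"] char_0 by (simp flip: complex_norm_square)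
  then show ?thesis
    using norm_char[of i] by (metis mult_left_cancel norm_zero zero_neq_one)
qed

lemma abs_summable_transform:
  "c abs_summable_on UNIV \<Longrightarrow> (\<lambda>j. of_real (c j) * \<eta> j) abs_summable_on UNIV"
  by (simp add: norm_mult)

text \<open>Writing \<open>\<eta> h = \<eta> (h - k) * \<eta> k\<close> distributes the character
  over the two factors, so the weighted convolution is the convolution of the weighted
  families.\<close>

lemma transform_convolution:
  assumes c: "c abs_summable_on UNIV" and d: "d abs_summable_on UNIV"
  shows "transform \<eta> (\<lambda>h. \<Sum>\<^sub>\<infinity>k. c (h - k) * d k) = transform \<eta> c * transform \<eta> d"
proof -
  have "of_real (\<Sum>\<^sub>\<infinity>k. c (h - k) * d k) * \<eta> h
      = (\<Sum>\<^sub>\<infinity>k. (of_real (c (h - k)) * \<eta> (h - k)) * (of_real (d k) * \<eta> k))" for h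
  proof -
    have "\<eta> h = \<eta> (h - k) * \<eta> k" for k
      using char_add[of "h - k" k] by simp
    then have "(\<Sum>\<^sub>\<infinity>k. (of_real (c (h - k)) * \<eta> (h - k)) * (of_real (d k) * \<eta> k))
        = (\<Sum>\<^sub>\<infinity>k. of_real (c (h - k) * d k) * \<eta> h)"
      by (intro infsum_cong) (metis (no_types, lifting) mult.assoc mult.commute of_real_mult)
    also have "\<dots> = of_real (\<Sum>\<^sub>\<infinity>k. c (h - k) * d k) * \<eta> h"
      unfolding infsum_cmult_left' using abs_summable_convolution_term[OF c d]
      by (intro arg_cong2[where f = "(*)"] infsumI has_sum_of_real has_sum_infsum refl)
        (rule abs_summable_summable)
    finally show ?thesis ..
  qed
  then show ?thesis
    unfolding transform_def
    using infsum_convolution[OF abs_summable_transform[OF c] abs_summable_transform[OF d]] by simp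
qed

text \<open>The coefficients are real, so conjugation acts on the character alone, where it negates
  the index.\<close>

lemma transform_uminus: "transform \<eta> (\<lambda>j. c (- j)) = cnj (transform \<eta> c)"
proof -
  have "transform \<eta> (\<lambda>j. c (- j)) = (\<Sum>\<^sub>\<infinity>j. of_real (c j) * \<eta> (- j))"
    unfolding transform_def
    by (rule infsum_reindex_bij_witness[of _ uminus uminus]) auto
  then show ?thesis
    by (simp add: transform_def char_minus flip: infsum_cnj)
qed

end

lemma abs_summable_uminus:
  fixes c :: "'a::ab_group_add \<Rightarrow> real"
  assumes "c abs_summable_on UNIV"
  shows "(\<lambda>j. c (- j)) abs_summable_on UNIV"
  using assms
  by (subst summable_on_reindex_bij_betw[of uminus, where f = "\<lambda>j. norm (c j)"])
     (auto simp: bij_uminus)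

text \<open>Summation over the whole group, instead of nonnegative indices, makes reindexing by
  negation available.\<close>

definition autocov :: "('a::ab_group_add \<Rightarrow> real) \<Rightarrow> 'a \<Rightarrow> real" where
  "autocov c h = (\<Sum>\<^sub>\<infinity>k. c (h + k) * c k)"

text \<open>Replacing \<open>k\<close> by \<open>- k\<close> exhibits the autocovariance as the
  convolution of \<open>c\<close> with its reflection; hence its transform is a squared
  modulus.\<close>

lemma autocov_eq_convolution: "autocov c h = (\<Sum>\<^sub>\<infinity>k. c (h - k) * c (- k))"
  unfolding autocov_def by (rule infsum_reindex_bij_witness[of _ uminus uminus]) auto

lemma abs_summable_autocov_term:
  fixes c :: "'a::ab_group_add \<Rightarrow> real"
  assumes "c abs_summable_on UNIV"
  shows "(\<lambda>k. c (h + k) * c k) abs_summable_on UNIV"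
  using abs_summable_convolution_term[OF assms abs_summable_uminus[OF assms], of h]
    summable_on_reindex_bij_betw[of uminus UNIV UNIV "\<lambda>k. norm (c (h + k) * c k)"]
  by (simp add: bij_uminus)

lemma abs_summable_autocov:
  fixes c :: "'a::ab_group_add \<Rightarrow> real"
  assumes "c abs_summable_on UNIV"
  shows "autocov c abs_summable_on UNIV"
  unfolding autocov_eq_convolution
  by (rule abs_summable_convolution[OF assms abs_summable_uminus[OF assms]])

lemma (in unitary_character) transform_autocov:
  assumes "c abs_summable_on UNIV"
  shows "transform \<eta> (autocov c) = transform \<eta> c * cnj (transform \<eta> c)"
  unfolding autocov_eq_convolution[abs_def]
  by (simp add: transform_convolution[OF assms abs_summable_uminus[OF assms]] transform_uminus[of c])

subsection \<open>Fourier inversion on the torus\<close>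

abbreviation char2 :: "complex \<Rightarrow> complex \<Rightarrow> int \<times> int \<Rightarrow> complex" where
  "char2 u v \<equiv> (\<lambda>(j1, j2). u powi j1 * v powi j2)"

lemma unitary_character_powi:
  assumes "norm u = 1"
  shows "unitary_character (\<lambda>j. u powi j)"
proof -
  have "u \<noteq> 0" using assms by auto
  with assms show ?thesis
    by unfold_locales (auto simp: norm_power_int power_int_add)
qed

lemma unitary_character_char2:
  assumes "norm u = 1" "norm v = 1"
  shows "unitary_character (char2 u v)"
proof -
  have "u \<noteq> 0" "v \<noteq> 0" using assms by auto
  with assms show ?thesis
    by unfold_locales (auto simp: norm_mult norm_power_int power_int_add)
qed

lemma has_integral_exp_powi:
  "((\<lambda>t. exp (- \<i> * of_real t) powi n) has_integral (if n = 0 then 2 * of_real pi else 0)) {-pi..pi}"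
proof (cases "n = 0")
  case True
  then show ?thesis
    using has_integral_const_real[of "1::complex" "-pi" pi] by (simp add: scaleR_conv_of_real)
next
  case False
  define F where "F = (\<lambda>z. exp (- \<i> * of_int n * z) / (- \<i> * of_int n))"
  have "(F has_field_derivative exp (- \<i> * of_int n * z)) (at z)" for z
    using False unfolding F_def by (auto intro!: derivative_eq_intros)
  then have "((\<lambda>t. exp (- \<i> * of_int n * of_real t)) has_integral
      (F (of_real pi) - F (of_real (- pi)))) {-pi..pi}"
    by (intro fundamental_theorem_of_calculus has_vector_derivative_real_field) auto
  \<comment> \<open>The two exponents differ by \<open>- n\<close> times the period
    \<open>2 * pi * \<i>\<close>.\<close>
  moreover have "exp (- \<i> * of_int n * of_real pi) = exp (\<i> * of_int n * of_real pi)"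
    unfolding exp_eq by (intro exI[of _ "- n"]) (simp add: algebra_simps)
  then have "F (of_real pi) = F (of_real (- pi))"
    by (simp add: F_def)
  ultimately show ?thesis
    using False by (simp add: exp_power_int mult_ac)
qed

text \<open>The series is dominated by \<open>norm (c j)\<close> uniformly on the square, so it may
  be integrated term by term; orthogonality of the exponentials leaves only the term at
  \<open>(h1, h2)\<close>.\<close>

lemma spectral_acov_transform:
  fixes c :: "int \<times> int \<Rightarrow> real"
  assumes c: "c abs_summable_on UNIV"
  shows "spectral_acov (\<lambda>t1 t2. transform (char2 (exp (- \<i> * t1)) (exp (- \<i> * t2))) c) h1 h2
    = of_real (c (h1, h2))"
proof -
  \<comment> \<open>Points are ordered as \<open>(t2, t1)\<close> because \<open>t2\<close> is the
    outer variable of \<open>spectral_acov\<close>.\<close>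
  define g :: "int \<times> int \<Rightarrow> real \<times> real \<Rightarrow> complex" where
    "g = (\<lambda>(j1, j2) (t2, t1). of_real (c (j1, j2)) *
      (exp (- \<i> * t2) powi (j2 - h2) * exp (- \<i> * t1) powi (j1 - h1)))"
  define G where "G = (\<lambda>(t2, t1). transform (char2 (exp (- \<i> * of_real t1)) (exp (- \<i> * of_real t2))) c
    * exp (- \<i> * of_real t1) powi (- h1) * exp (- \<i> * of_real t2) powi (- h2))"
  let ?Q = "cbox (-pi, -pi) (pi, pi)"
  have cont: "continuous_on A (g j)" for A j
    unfolding g_def by (cases j) (auto simp: case_prod_unfold intro!: continuous_intros)
  have G: "G t = (\<Sum>\<^sub>\<infinity>j. g j t)" for t
    by (cases t) (auto simp: G_def g_def transform_def power_int_diff power_int_minus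
        divide_inverse case_prod_unfold mult_ac simp flip: infsum_cmult_left' infsum_cmult_right' intro!: infsum_cong)
  have "norm (g j t) \<le> norm (c j)" for j t
    by (cases j; cases t) (simp add: g_def norm_mult norm_power_int)
  then have lim: "uniform_limit ?Q (\<lambda>X t. \<Sum>j\<in>X. g j t) G (finite_subsets_at_top UNIV)"
    unfolding G using c by (intro Weierstrass_m_test_general) auto
  obtain I J where I: "\<And>X. ((\<lambda>t. \<Sum>j\<in>X. g j t) has_integral I X) ?Q"
    and J: "(G has_integral J) ?Q" and IJ: "(I \<longlongrightarrow> J) (finite_subsets_at_top UNIV)"
    by (rule uniform_limit_integral_cbox[OF lim])
      (auto intro!: continuous_on_sum cont)
  have exp_int: "integral {-pi..pi} (\<lambda>t. exp (- (\<i> * of_real t)) powi n)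
      = (if n = 0 then 2 * of_real pi else 0)" for n
    using integral_unique[OF has_integral_exp_powi[of n]] by simp
  have g_int: "integral ?Q (g j) = (if j = (h1, h2) then 4 * pi\<^sup>2 * c (h1, h2) else 0)" for j
    unfolding integral_prod_continuous[OF cont]
    by (cases j) (auto simp: g_def exp_int power2_eq_square scaleR_conv_of_real)
  \<comment> \<open>The integrated partial sums are constant once the finite index set contains
    \<open>(h1, h2)\<close>, which fixes their limit \<open>J\<close>.\<close>
  have I_eq: "I X = 4 * pi\<^sup>2 * c (h1, h2)" if "finite X" "(h1, h2) \<in> X" for X
  proof -
    have "I X = (\<Sum>j\<in>X. integral ?Q (g j))"
      using I[of X] by (subst integral_sum[symmetric])
        (auto intro!: that integrable_continuous cont simp: integral_unique)
    then show ?thesis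
      using that by (simp add: g_int if_distrib[of complex_of_real] cong: if_cong)
  qed
  have "eventually (\<lambda>X. I X = 4 * pi\<^sup>2 * c (h1, h2)) (finite_subsets_at_top UNIV)"
    unfolding eventually_finite_subsets_at_top
    by (rule exI[of _ "{(h1, h2)}"]) (auto simp: I_eq)
  then have "J = 4 * pi\<^sup>2 * c (h1, h2)"
    by (intro tendsto_unique[OF _ IJ tendsto_eventually]) auto
  moreover have "continuous_on ?Q G"
    by (rule uniform_limit_theorem[OF _ lim]) (auto intro!: continuous_on_sum cont)
  then have "J = integral {-pi..pi} (\<lambda>t2. integral {-pi..pi} (\<lambda>t1. G (t2, t1)))"
    using J integral_prod_continuous[of "-pi" "-pi" pi pi G] by (simp add: integral_unique)
  ultimately show ?thesis
    by (simp add: spectral_acov_def G_def)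
qed

subsection \<open>Coefficients of the causal, skew and axis fields\<close>

lemma psi_coeff_neg [simp]: "j1 < 0 \<or> j2 < 0 \<Longrightarrow> psi_coeff p \<Theta> j1 j2 = 0"
  by (subst psi_coeff.simps) simp

lemma psi_coeff_0: "psi_coeff p \<Theta> 0 j2 = (if j2 = 0 then 1 else 0)"
  by (subst psi_coeff.simps) auto

text \<open>The inner range \<open>1..j2\<close> may become \<open>1..int p\<close>: terms with
  \<open>k2 > j2\<close> vanish through the coefficient, those with \<open>k2 > int p\<close>
  through \<open>\<Theta>\<close>. The range no longer depends on \<open>j2\<close>.\<close>

lemma psi_coeff_rec:
  assumes \<Theta>: "\<And>k1 k2. k2 > int p \<Longrightarrow> \<Theta> k1 k2 = 0" and "j1 \<ge> 1"
  shows "of_int j1 * psi_coeff p \<Theta> j1 j2 = (\<Sum>k1=1..int p. of_int k1 *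
           (\<Sum>k2=1..int p. psi_coeff p \<Theta> (j1 - k1) (j2 - k2) * \<Theta> k1 k2))"
proof -
  have "(\<Sum>k2=1..j2. psi_coeff p \<Theta> (j1 - k1) (j2 - k2) * \<Theta> k1 k2)
      = (\<Sum>k2=1..int p. psi_coeff p \<Theta> (j1 - k1) (j2 - k2) * \<Theta> k1 k2)" for k1
    by (rule sum.mono_neutral_cong) (auto simp: \<Theta>)
  moreover have "of_int j1 * psi_coeff p \<Theta> j1 j2 = (\<Sum>k1=1..int p. of_int k1 *
           (\<Sum>k2=1..j2. psi_coeff p \<Theta> (j1 - k1) (j2 - k2) * \<Theta> k1 k2))"
    using \<open>j1 \<ge> 1\<close> by (subst psi_coeff.simps) auto
  ultimately show ?thesis by simp
qed

text \<open>Row \<open>j1\<close> becomes a finite linear combination of shifts of earlier rows,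
  with weights independent of \<open>j2\<close>.\<close>

lemma psi_coeff_row_rec:
  assumes \<Theta>: "\<And>k1 k2. k2 > int p \<Longrightarrow> \<Theta> k1 k2 = 0" and "j1 \<ge> 1"
  shows "psi_coeff p \<Theta> j1 j2 = (\<Sum>k1=1..int p. \<Sum>k2=1..int p.
           of_int k1 * \<Theta> k1 k2 / of_int j1 * psi_coeff p \<Theta> (j1 - k1) (j2 - k2))"
proof -
  have "psi_coeff p \<Theta> j1 j2 = (\<Sum>k1=1..int p. of_int k1 *
      (\<Sum>k2=1..int p. psi_coeff p \<Theta> (j1 - k1) (j2 - k2) * \<Theta> k1 k2)) / of_int j1"
    using \<open>j1 \<ge> 1\<close> by (subst psi_coeff_rec[of p \<Theta> j1 j2, OF \<Theta> \<open>j1 \<ge> 1\<close>, symmetric]) auto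
  then show ?thesis
    by (simp add: sum_distrib_left sum_divide_distrib mult_ac)
qed

lemma has_sum_sum:
  fixes f :: "'i \<Rightarrow> 'a \<Rightarrow> 'b::topological_comm_monoid_add"
  assumes "\<And>i. i \<in> I \<Longrightarrow> (f i has_sum s i) A"
  shows "((\<lambda>x. \<Sum>i\<in>I. f i x) has_sum (\<Sum>i\<in>I. s i)) A"
  using assms by (induction I rule: infinite_finite_induct) (auto intro!: has_sum_add)

lemma summable_on_sum:
  fixes f :: "'i \<Rightarrow> 'a \<Rightarrow> 'b::topological_comm_monoid_add"
  assumes "\<And>i. i \<in> I \<Longrightarrow> f i summable_on A"
  shows "(\<lambda>x. \<Sum>i\<in>I. f i x) summable_on A"
  using assms by (induction I rule: infinite_finite_induct) (auto intro!: summable_on_add)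

lemma summable_shift:
  fixes c :: "int \<Rightarrow> real"
  assumes "c summable_on UNIV"
  shows "(\<lambda>j. c (j - k)) summable_on UNIV"
  using summable_on_reindex_bij_betw[of "\<lambda>j. j - k" UNIV UNIV c] assms
  by (simp add: bij_betw_byWitness[where f' = "\<lambda>j. j + k"])

text \<open>Induction over rows: row 0 is supported at 0, and shifts and finite linear combinations
  preserve summability.\<close>

lemma summable_psi_coeff_row:
  assumes \<Theta>: "\<And>k1 k2. k2 > int p \<Longrightarrow> \<Theta> k1 k2 = 0"
  shows "psi_coeff p \<Theta> j1 summable_on UNIV"
proof (induction "nat j1" arbitrary: j1 rule: less_induct)
  case less
  consider "j1 < 0" | "j1 = 0" | "j1 \<ge> 1" by linarith
  then show ?case
  proof cases
    case 1
    then have "psi_coeff p \<Theta> j1 = (\<lambda>_. 0)" by auto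
    then show ?thesis by simp
  next
    case 2
    have "psi_coeff p \<Theta> 0 summable_on {0}" by simp
    then show ?thesis
      unfolding 2 by (rule summable_on_cong_neutral[THEN iffD1, rotated -1]) (auto simp: psi_coeff_0)
  next
    case 3
    have "(\<lambda>j2. \<Sum>k1=1..int p. \<Sum>k2=1..int p.
        of_int k1 * \<Theta> k1 k2 / of_int j1 * psi_coeff p \<Theta> (j1 - k1) (j2 - k2)) summable_on UNIV"
      by (intro summable_on_sum summable_on_cmult_right summable_shift less) (use 3 in auto)
    then show ?thesis
      using psi_coeff_row_rec[of p \<Theta> j1, OF \<Theta> 3] by (auto cong: summable_on_cong)
  qed
qed

text \<open>Transforming each row in its second index turns a shift by \<open>k2\<close> into the
  factor \<open>v powi k2\<close>. For fixed \<open>v\<close> the row transforms thus obey the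
  one-variable recursion with parameters
  \<open>\<Sum>k2. \<Theta> k1 k2 * v powi k2\<close>.\<close>

lemma psi_coeff_row_has_sum:
  assumes \<Theta>: "\<And>k1 k2. k2 > int p \<Longrightarrow> \<Theta> k1 k2 = 0" and v: "norm v = 1"
  shows "((\<lambda>j1. transform (\<lambda>j2. v powi j2) (psi_coeff p \<Theta> j1) * u powi j1) has_sum
     exp (\<Sum>k1=1..int p. \<Sum>k2=1..int p. \<Theta> k1 k2 * (u powi k1 * v powi k2))) UNIV"
proof -
  let ?T = "transform (\<lambda>j2. v powi j2)"
  have row: "((\<lambda>j2. of_real (psi_coeff p \<Theta> j1 (j2 - k)) * v powi j2) has_sum
      v powi k * ?T (psi_coeff p \<Theta> j1)) UNIV" for j1 k
  proof -
    have v0: "v \<noteq> 0" using v by auto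
    have "psi_coeff p \<Theta> j1 abs_summable_on UNIV"
      using summable_psi_coeff_row[of p \<Theta> j1, OF \<Theta>] summable_on_iff_abs_summable_on_real by blast
    then have "(\<lambda>j2. of_real (psi_coeff p \<Theta> j1 j2) * v powi j2) abs_summable_on UNIV"
      using v by (simp add: norm_mult norm_power_int)
    from has_sum_infsum[OF abs_summable_summable[OF this]]
    have "((\<lambda>j2. of_real (psi_coeff p \<Theta> j1 j2) * v powi j2) has_sum ?T (psi_coeff p \<Theta> j1)) UNIV"
      by (simp add: transform_def)
    then have "((\<lambda>j2. of_real (psi_coeff p \<Theta> j1 (j2 - k)) * v powi (j2 - k)) has_sum
        ?T (psi_coeff p \<Theta> j1)) UNIV"
      by (subst has_sum_reindex_bij_betw[of "\<lambda>j. j - k" UNIV UNIV])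
        (auto intro!: bij_betw_byWitness[where f' = "\<lambda>j. j + k"])
    from has_sum_cmult_right[OF this, of "v powi k"] show ?thesis
      using v0 by (simp add: power_int_diff mult_ac)
  qed
  have "((\<lambda>j1. ?T (psi_coeff p \<Theta> j1) * u powi j1) has_sum
     exp (\<Sum>k1=1..int p. (\<Sum>k2=1..int p. \<Theta> k1 k2 * v powi k2) * u powi k1)) UNIV"
  proof (rule exp_poly_recursion_has_sum)
    show "?T (psi_coeff p \<Theta> 0) = 1"
      using infsum_cong_neutral[of "{0}" UNIV "\<lambda>j. of_real (psi_coeff p \<Theta> 0 j) * v powi j"
          "\<lambda>j. of_real (psi_coeff p \<Theta> 0 j) * v powi j"]
      by (simp add: transform_def psi_coeff_0)
  next
    fix j1 :: int assume "j1 < 0"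
    then show "?T (psi_coeff p \<Theta> j1) = 0"
      by (simp add: transform_def)
  next
    fix j1 :: int assume j1: "j1 \<ge> 1"
    have "((\<lambda>j2. \<Sum>k1=1..int p. \<Sum>k2=1..int p. of_real (of_int k1 * \<Theta> k1 k2 / of_int j1) *
        (of_real (psi_coeff p \<Theta> (j1 - k1) (j2 - k2)) * v powi j2)) has_sum
        (\<Sum>k1=1..int p. \<Sum>k2=1..int p. of_real (of_int k1 * \<Theta> k1 k2 / of_int j1) *
        (v powi k2 * ?T (psi_coeff p \<Theta> (j1 - k1))))) UNIV"
      by (intro has_sum_sum has_sum_cmult_right row)
    also have "(\<lambda>j2. \<Sum>k1=1..int p. \<Sum>k2=1..int p. of_real (of_int k1 * \<Theta> k1 k2 / of_int j1) *
        (of_real (psi_coeff p \<Theta> (j1 - k1) (j2 - k2)) * v powi j2))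
      = (\<lambda>j2. of_real (psi_coeff p \<Theta> j1 j2) * v powi j2)"
      by (subst psi_coeff_row_rec[OF \<Theta> j1]) (simp_all add: sum_distrib_left sum_distrib_right mult_ac)
    finally have "?T (psi_coeff p \<Theta> j1) = (\<Sum>k1=1..int p. \<Sum>k2=1..int p.
        of_real (of_int k1 * \<Theta> k1 k2 / of_int j1) * (v powi k2 * ?T (psi_coeff p \<Theta> (j1 - k1))))"
      unfolding transform_def by (rule infsumI)
    then show "of_int j1 * ?T (psi_coeff p \<Theta> j1) = (\<Sum>k1=1..int p. of_int k1 *
        (\<Sum>k2=1..int p. \<Theta> k1 k2 * v powi k2) * ?T (psi_coeff p \<Theta> (j1 - k1)))"
      using j1 by (simp add: sum_distrib_left sum_distrib_right mult_ac)
  qed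
  then show ?thesis
    by (simp add: sum_distrib_left sum_distrib_right mult_ac)
qed

text \<open>The coefficients for \<open>\<bar>\<Theta>\<bar>\<close> are nonnegative, so their summability over \<open>\<int> \<times> \<int>\<close> reduces to
  convergence of the power series of row sums at \<open>u = v = 1\<close>.\<close>

lemma psi_coeff_abs_le: "\<bar>psi_coeff p \<Theta> j1 j2\<bar> \<le> psi_coeff p (\<lambda>k1 k2. \<bar>\<Theta> k1 k2\<bar>) j1 j2"
proof (induction "nat j1" arbitrary: j1 j2 rule: less_induct)
  case less
  show ?case
  proof (cases "j1 \<ge> 1 \<and> j2 \<ge> 1")
    case True
    have "\<bar>\<Sum>k1=1..int p. of_int k1 * (\<Sum>k2=1..j2. psi_coeff p \<Theta> (j1 - k1) (j2 - k2) * \<Theta> k1 k2)\<bar>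
      \<le> (\<Sum>k1=1..int p. of_int k1 *
          (\<Sum>k2=1..j2. psi_coeff p (\<lambda>k1 k2. \<bar>\<Theta> k1 k2\<bar>) (j1 - k1) (j2 - k2) * \<bar>\<Theta> k1 k2\<bar>))"
      using True
      by (auto simp: abs_mult intro!: order_trans[OF sum_abs] sum_mono mult_left_mono
          mult_right_mono less)
    then show ?thesis
      using True by (subst (1 2) psi_coeff.simps) (auto simp: abs_mult intro!: divide_right_mono)
  next
    case False
    then show ?thesis by (subst (1 2) psi_coeff.simps) auto
  qed
qed

lemma abs_summable_psi_coeff:
  assumes \<Theta>: "\<And>k1 k2. k2 > int p \<Longrightarrow> \<Theta> k1 k2 = 0"
  shows "(\<lambda>(j1, j2). psi_coeff p \<Theta> j1 j2) abs_summable_on UNIV"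
proof -
  define c where "c = psi_coeff p (\<lambda>k1 k2. \<bar>\<Theta> k1 k2\<bar>)"
  have row: "(c j1 has_sum infsum (c j1) UNIV) UNIV" for j1
    unfolding c_def using \<Theta> by (intro has_sum_infsum summable_psi_coeff_row) auto
  \<comment> \<open>At \<open>v = 1\<close> the transform of a row is its plain sum.\<close>
  have "transform (\<lambda>j2. 1 powi j2) (c j1) = of_real (infsum (c j1) UNIV)" for j1
    using infsumI[OF has_sum_of_real[OF row, where ?'a = complex]] by (simp add: transform_def)
  moreover have "(\<lambda>j1. transform (\<lambda>j2. 1 powi j2) (c j1) * 1 powi j1) summable_on UNIV"
    unfolding c_def by (rule has_sum_imp_summable[OF psi_coeff_row_has_sum]) (auto simp: \<Theta>)
  ultimately have "(\<lambda>j1. complex_of_real (infsum (c j1) UNIV)) summable_on UNIV"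
    by simp
  then have "(\<lambda>j1. infsum (c j1) UNIV) summable_on UNIV"
    using summable_on_Re by fastforce
  \<comment> \<open>\<open>c\<close> dominates an absolute value; nonnegativity lets summable rows
    with summable row sums give joint summability.\<close>
  moreover have nonneg: "c j1 j2 \<ge> 0" for j1 j2
    using psi_coeff_abs_le[of p \<Theta> j1 j2] by (simp add: c_def)
  ultimately have "(\<lambda>(j1, j2). c j1 j2) summable_on UNIV \<times> UNIV"
    by (intro summable_on_SigmaI[where g = "\<lambda>j1. infsum (c j1) UNIV"]) (use row in auto)
  then show ?thesis
    by (intro Infinite_Sum.abs_summable_on_comparison_test'[of "\<lambda>(j1, j2). c j1 j2"])
      (auto simp: c_def psi_coeff_abs_le)
qed

text \<open>Joint absolute summability permits evaluating the double series row by row.\<close>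

lemma transform_psi_coeff:
  assumes \<Theta>: "\<And>k1 k2. k2 > int p \<Longrightarrow> \<Theta> k1 k2 = 0" and "norm u = 1" and "norm v = 1"
  shows "transform (char2 u v) (\<lambda>(j1, j2). psi_coeff p \<Theta> j1 j2)
     = exp (\<Sum>k1=1..int p. \<Sum>k2=1..int p. \<Theta> k1 k2 * (u powi k1 * v powi k2))"
proof -
  interpret unitary_character "char2 u v"
    using assms by (rule_tac unitary_character_char2)
  have "(\<lambda>(j1, j2). of_real (psi_coeff p \<Theta> j1 j2) * (u powi j1 * v powi j2)) summable_on UNIV \<times> UNIV"
    using abs_summable_summable[OF abs_summable_transform[OF abs_summable_psi_coeff[OF \<Theta>]]]
    by (simp add: case_prod_unfold)
  from infsum_Sigma_banach[OF this]
  have "transform (char2 u v) (\<lambda>(j1, j2). psi_coeff p \<Theta> j1 j2)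
      = (\<Sum>\<^sub>\<infinity>j1. transform (\<lambda>j2. v powi j2) (psi_coeff p \<Theta> j1) * u powi j1)"
    by (simp add: transform_def case_prod_unfold mult_ac flip: infsum_cmult_left' infsum_cmult_right')
  also have "\<dots> = exp (\<Sum>k1=1..int p. \<Sum>k2=1..int p. \<Theta> k1 k2 * (u powi k1 * v powi k2))"
    by (rule infsumI[OF psi_coeff_row_has_sum]) (use assms in auto)
  finally show ?thesis .
qed

section \<open>Coefficients of the axis fields\<close>

lemma axis_coeff_neg: "j < 0 \<Longrightarrow> axis_coeff p \<theta> j = 0"
  by (subst axis_coeff.simps) simp

lemma axis_coeff_has_sum:
  "((\<lambda>j. complex_of_real (axis_coeff p \<theta> j) * u powi j) has_sum
     exp (\<Sum>k=1..int p. of_real (\<theta> k) * u powi k)) UNIV"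
proof (rule exp_poly_recursion_has_sum)
  fix j :: int assume "j \<ge> 1"
  then have "of_int j * axis_coeff p \<theta> j = (\<Sum>k=1..int p. of_int k * \<theta> k * axis_coeff p \<theta> (j - k))"
    by (subst axis_coeff.simps) auto
  from arg_cong[OF this, of complex_of_real]
  show "of_int j * complex_of_real (axis_coeff p \<theta> j)
      = (\<Sum>k=1..int p. of_int k * of_real (\<theta> k) * of_real (axis_coeff p \<theta> (j - k)))"
    by simp
qed (subst axis_coeff.simps, simp)+

text \<open>At \<open>u = 1\<close> the series is the plain sum of coefficients, and unordered
  summability of complex families is absolute.\<close>

lemma abs_summable_axis_coeff: "axis_coeff p \<theta> abs_summable_on UNIV"
  using has_sum_imp_summable[OF axis_coeff_has_sum[of p \<theta> 1]]
  by (simp add: summable_on_iff_abs_summable_on_complex)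

lemma transform_axis_coeff:
  "transform (\<lambda>j. u powi j) (axis_coeff p \<theta>) = exp (\<Sum>k=1..int p. of_real (\<theta> k) * u powi k)"
  unfolding transform_def by (rule infsumI[OF axis_coeff_has_sum])

subsection \<open>Autocovariances and factorization of the density\<close>

lemma abs_summable_flip_fst:
  fixes c :: "int \<times> int \<Rightarrow> real"
  assumes "c abs_summable_on UNIV"
  shows "(\<lambda>(j1, j2). c (- j1, j2)) abs_summable_on UNIV"
proof -
  have "bij (\<lambda>(j1, j2). (- j1 :: int, j2 :: int))"
    by (rule bijI) (auto simp: inj_def image_def, metis minus_minus)
  from summable_on_reindex_bij_betw[OF this, of "\<lambda>j. norm (c j)"] show ?thesis
    using assms by (simp add: case_prod_unfold)
qed

text \<open>Accounts for the skew field being a series in the inverse of the first shift.\<close>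

lemma transform_flip_fst:
  "transform (char2 u v) (\<lambda>(j1, j2). c (- j1, j2)) = transform (char2 (inverse u) v) c"
  unfolding transform_def
  by (rule infsum_reindex_bij_witness[of _ "\<lambda>(j1, j2). (- j1, j2)" "\<lambda>(j1, j2). (- j1, j2)"])
    (auto simp: power_int_minus power_int_inverse)

lemma transform_tensor:
  assumes u: "norm u = 1" and v: "norm v = 1"
    and c: "c abs_summable_on UNIV" and d: "d abs_summable_on UNIV"
  shows "transform (char2 u v) (\<lambda>(j1, j2). c j1 * d j2)
     = transform (\<lambda>j. u powi j) c * transform (\<lambda>j. v powi j) d"
proof -
  note * = unitary_character.abs_summable_transform[OF unitary_character_powi]
  show ?thesis
    using infsum_tensor[OF *[OF u c] *[OF v d]]
    by (simp add: transform_def case_prod_unfold mult_ac)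
qed

lemma transform_cmult: "transform \<eta> (\<lambda>j. a * c j) = of_real a * transform \<eta> c"
  by (simp add: transform_def mult.assoc infsum_cmult_right')

text \<open>Terms with \<open>k < 0\<close> vanish through the factor \<open>c k\<close>, so
  extending the sum to all integers changes nothing.\<close>

lemma
  assumes neg: "\<And>j. j < 0 \<Longrightarrow> c j = 0" and c: "c abs_summable_on UNIV"
  shows acov1_convergesI: "acov1_converges c"
    and acov1_eq_autocov: "acov1 c = autocov c"
proof -
  have "(\<lambda>k. c (h + k) * c k) summable_on {0..}" for h
    using abs_summable_summable[OF abs_summable_autocov_term[OF c, of h]]
    by (rule summable_on_subset_banach) auto
  then show "acov1_converges c"
    by (simp add: acov1_converges_def add.commute)
  show "acov1 c = autocov c"
    unfolding acov1_def autocov_def fun_eq_iff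
    by (auto intro!: infsum_cong_neutral simp: add.commute) (use neg in force)
qed

lemma
  assumes neg: "\<And>j1 j2. j1 < 0 \<or> j2 < 0 \<Longrightarrow> c j1 j2 = 0"
    and c: "(\<lambda>(j1, j2). c j1 j2) abs_summable_on UNIV"
  shows acov2_convergesI: "acov2_converges c"
    and acov2_eq_autocov: "acov2 c s1 s2 = autocov (\<lambda>(j1, j2). c j1 j2) (s1, s2)"
proof -
  have "(\<lambda>(k1, k2). c (s1 + k1) (s2 + k2) * c k1 k2) summable_on {0..} \<times> {0..}" for s1 s2
    using abs_summable_summable[OF abs_summable_autocov_term[OF c, of "(s1, s2)"]]
    by (rule summable_on_subset_banach[THEN summable_on_cong[THEN iffD1, rotated]]) auto
  then show "acov2_converges c"
    by (simp add: acov2_converges_def)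
  show "acov2 c s1 s2 = autocov (\<lambda>(j1, j2). c j1 j2) (s1, s2)"
    unfolding acov2_def autocov_def
    by (rule infsum_cong_neutral) (use neg in \<open>force+\<close>)
qed

section \<open>Factorization of the density into squared moduli\<close>

lemma sum_symmetric_int:
  fixes g :: "int \<Rightarrow> 'a::comm_monoid_add"
  shows "(\<Sum>j=- int p..int p. g j) = g 0 + ((\<Sum>j=1..int p. g j) + (\<Sum>j=1..int p. g (- j)))"
proof -
  have "{- int p..int p} = insert 0 ({1..int p} \<union> {- int p..-1})" by auto
  moreover have "(\<Sum>j=- int p..-1. g j) = (\<Sum>j=1..int p. g (- j))"
    by (rule sum.reindex_bij_witness[of _ uminus uminus]) auto
  ultimately show ?thesis
    by (simp add: sum.union_disjoint)
qed

lemma exp_trig_poly_factorization: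
  fixes \<Theta> :: "int \<Rightarrow> int \<Rightarrow> real" and u v :: complex
  assumes \<Theta>: "\<And>j1 j2. \<bar>j1\<bar> \<le> int p \<Longrightarrow> \<bar>j2\<bar> \<le> int p \<Longrightarrow> \<Theta> j1 j2 = \<Theta> (- j1) (- j2)"
    and u: "norm u = 1" and v: "norm v = 1"
  defines "A \<equiv> exp (\<Sum>k1=1..int p. \<Sum>k2=1..int p. \<Theta> k1 k2 * (u powi k1 * v powi k2))"
    and "B \<equiv> exp (\<Sum>k1=1..int p. \<Sum>k2=1..int p. \<Theta> (- k1) k2 * (inverse u powi k1 * v powi k2))"
    and "C \<equiv> exp (\<Sum>k=1..int p. \<Theta> k 0 * u powi k)"
    and "D \<equiv> exp (\<Sum>k=1..int p. \<Theta> 0 k * v powi k)"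
  shows "exp (\<Sum>j1=- int p..int p. \<Sum>j2=- int p..int p. \<Theta> j1 j2 * u powi j1 * v powi j2)
    = of_real (exp (\<Theta> 0 0)) * ((A * cnj A) * (C * cnj C * (D * cnj D)) * (B * cnj B))"
proof -
  define g where "g = (\<lambda>j1 j2. complex_of_real (\<Theta> j1 j2) * u powi j1 * v powi j2)"
  have "cnj (w powi j) = w powi (- j)" if "norm w = 1" for w j
    using unitary_character.char_minus[OF unitary_character_powi[OF that]] by simp
  \<comment> \<open>Conjugation negates the exponents of unimodular \<open>u\<close> and
    \<open>v\<close>, and the symmetry of \<open>\<Theta>\<close> absorbs the sign change.\<close>
  then have cnj_g: "cnj (g j1 j2) = g (- j1) (- j2)" if "\<bar>j1\<bar> \<le> int p" "\<bar>j2\<bar> \<le> int p" for j1 j2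
    using u v \<Theta>[OF that] by (simp add: g_def)
  have A: "A = exp (\<Sum>k1=1..int p. \<Sum>k2=1..int p. g k1 k2)"
    by (simp add: A_def g_def mult.assoc)
  have B: "B = exp (\<Sum>k1=1..int p. \<Sum>k2=1..int p. g (- k1) k2)"
    by (simp add: B_def g_def mult.assoc power_int_minus power_int_inverse)
  have C: "C = exp (\<Sum>k=1..int p. g k 0)"
    by (simp add: C_def g_def)
  have D: "D = exp (\<Sum>k=1..int p. g 0 k)"
    by (simp add: D_def g_def)
  have cnjs: "cnj A = exp (\<Sum>k1=1..int p. \<Sum>k2=1..int p. g (- k1) (- k2))"
    "cnj B = exp (\<Sum>k1=1..int p. \<Sum>k2=1..int p. g k1 (- k2))"
    "cnj C = exp (\<Sum>k=1..int p. g (- k) 0)" "cnj D = exp (\<Sum>k=1..int p. g 0 (- k))"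
    by (auto simp: A B C D exp_cnj cnj_g intro!: arg_cong[where f = exp] sum.cong)
  have "of_real (exp (\<Theta> 0 0)) = exp (g 0 0)"
    by (simp add: g_def exp_of_real)
  \<comment> \<open>The bracketing mirrors that of the product in the conclusion, so
    \<open>exp_add\<close> read backwards finishes the proof.\<close>
  moreover have "(\<Sum>j1=- int p..int p. \<Sum>j2=- int p..int p. g j1 j2) = g 0 0
    + (((\<Sum>k1=1..int p. \<Sum>k2=1..int p. g k1 k2) + (\<Sum>k1=1..int p. \<Sum>k2=1..int p. g (- k1) (- k2)))
    + ((\<Sum>k=1..int p. g k 0) + (\<Sum>k=1..int p. g (- k) 0)
    + ((\<Sum>k=1..int p. g 0 k) + (\<Sum>k=1..int p. g 0 (- k))))
    + ((\<Sum>k1=1..int p. \<Sum>k2=1..int p. g (- k1) k2) + (\<Sum>k1=1..int p. \<Sum>k2=1..int p. g k1 (- k2))))"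
    by (simp add: sum_symmetric_int sum.distrib)
  moreover have "complex_of_real (\<Theta> j1 j2) * u powi j1 * v powi j2 = g j1 j2" for j1 j2
    by (simp add: g_def)
  ultimately show ?thesis
    unfolding cnjs unfolding A B C D by (simp only: exp_add[symmetric])
qed

text \<open>The convergence and summability conjuncts certify that every \<open>infsum\<close> in
  the formula is a genuine sum, not the default value 0.\<close>

theorem proposition2p1:
  fixes p :: nat and \<Theta> :: "int \<Rightarrow> int \<Rightarrow> real"
  assumes "p \<ge> 1"
    and "\<And>j1 j2. \<bar>j1\<bar> \<le> int p \<Longrightarrow> \<bar>j2\<bar> \<le> int p \<Longrightarrow> \<Theta> j1 j2 = \<Theta> (- j1) (- j2)"
    and "\<And>j1 j2. \<bar>j1\<bar> > int p \<or> \<bar>j2\<bar> > int p \<Longrightarrow> \<Theta> j1 j2 = 0"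
  shows "acov2_converges (psi_coeff p \<Theta>) \<and> acov2_converges (phi_coeff p \<Theta>) \<and>
    acov1_converges (xi_coeff p \<Theta>) \<and> acov1_converges (omega_coeff p \<Theta>) \<and>
    (\<forall>h1 h2.
      (\<forall>j1 j2. (\<lambda>(k1, k2). acov2 (psi_coeff p \<Theta>) (h1 + j1 - k1) (h2 - j2 - k2) *
          acov1 (xi_coeff p \<Theta>) k1 * acov1 (omega_coeff p \<Theta>) k2) summable_on UNIV) \<and>
      (\<lambda>(j1, j2). acov2 (phi_coeff p \<Theta>) j1 j2 *
          (\<Sum>\<^sub>\<infinity>(k1, k2). acov2 (psi_coeff p \<Theta>) (h1 + j1 - k1) (h2 - j2 - k2) *
             acov1 (xi_coeff p \<Theta>) k1 * acov1 (omega_coeff p \<Theta>) k2)) summable_on UNIV \<and>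
      spectral_acov (cepstral_density p \<Theta>) h1 h2 =
        complex_of_real (exp (\<Theta> 0 0) *
          (\<Sum>\<^sub>\<infinity>(j1, j2). acov2 (phi_coeff p \<Theta>) j1 j2 *
            (\<Sum>\<^sub>\<infinity>(k1, k2). acov2 (psi_coeff p \<Theta>) (h1 + j1 - k1) (h2 - j2 - k2) *
               acov1 (xi_coeff p \<Theta>) k1 * acov1 (omega_coeff p \<Theta>) k2))))"
proof -
  let ?psi = "psi_coeff p \<Theta>" and ?phi = "phi_coeff p \<Theta>"
    and ?xi = "xi_coeff p \<Theta>" and ?omega = "omega_coeff p \<Theta>"
  define \<psi> where "\<psi> = (\<lambda>(j1, j2). ?psi j1 j2)"
  define \<phi> where "\<phi> = (\<lambda>(j1, j2). ?phi j1 j2)"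
  have \<psi>: "\<psi> abs_summable_on UNIV"
    unfolding \<psi>_def by (rule abs_summable_psi_coeff) (simp add: assms(3))
  have \<phi>: "\<phi> abs_summable_on UNIV"
    unfolding \<phi>_def phi_coeff_def by (rule abs_summable_psi_coeff) (simp add: assms(3))
  have \<xi>: "?xi abs_summable_on UNIV" and \<omega>: "?omega abs_summable_on UNIV"
    unfolding xi_coeff_def omega_coeff_def by (rule abs_summable_axis_coeff)+
  have neg: "j1 < 0 \<or> j2 < 0 \<Longrightarrow> ?phi j1 j2 = 0" "j < 0 \<Longrightarrow> ?xi j = 0" "j < 0 \<Longrightarrow> ?omega j = 0"
    for j1 j2 j
    by (auto simp: phi_coeff_def xi_coeff_def omega_coeff_def axis_coeff_neg)
  note conv = acov2_convergesI[OF psi_coeff_neg \<psi>[unfolded \<psi>_def]]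
    acov2_convergesI[OF neg(1) \<phi>[unfolded \<phi>_def]]
    acov1_convergesI[OF neg(2) \<xi>] acov1_convergesI[OF neg(3) \<omega>]
  have acov_psi: "acov2 ?psi s1 s2 = autocov \<psi> (s1, s2)"
    and acov_phi: "acov2 ?phi s1 s2 = autocov \<phi> (s1, s2)" for s1 s2
    unfolding \<psi>_def \<phi>_def
    using acov2_eq_autocov[OF psi_coeff_neg \<psi>[unfolded \<psi>_def]]
      acov2_eq_autocov[OF neg(1) \<phi>[unfolded \<phi>_def]] by auto
  note acov1s = acov1_eq_autocov[OF neg(2) \<xi>] acov1_eq_autocov[OF neg(3) \<omega>]
  \<comment> \<open>\<open>M\<close> is the axis part, \<open>Q\<close> the bracketed inner sum, and
    \<open>R\<close> the full sum without its constant. \<open>E\<close> reflects the first index of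
    the skew autocovariance, so that \<open>R\<close> is an ordinary convolution.\<close>
  define M where "M = (\<lambda>(k1, k2). autocov ?xi k1 * autocov ?omega k2)"
  define E where "E = (\<lambda>(j1, j2). autocov \<phi> (- j1, j2))"
  define Q where "Q h = (\<Sum>\<^sub>\<infinity>k. autocov \<psi> (h - k) * M k)" for h
  define R where "R h = (\<Sum>\<^sub>\<infinity>j. Q (h - j) * E j)" for h
  have M: "M abs_summable_on UNIV"
    unfolding M_def by (intro abs_summable_tensor abs_summable_autocov \<xi> \<omega>)
  have E: "E abs_summable_on UNIV"
    unfolding E_def by (intro abs_summable_flip_fst abs_summable_autocov \<phi>)
  have Q: "Q abs_summable_on UNIV"
    unfolding Q_def by (intro abs_summable_convolution abs_summable_autocov \<psi> M)
  have R: "R abs_summable_on UNIV"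
    unfolding R_def by (intro abs_summable_convolution Q E)

  have inner: "(\<lambda>(k1, k2). acov2 ?psi (a - k1) (b - k2) * acov1 ?xi k1 * acov1 ?omega k2)
      = (\<lambda>k. autocov \<psi> ((a, b) - k) * M k)" for a b
    by (auto simp: acov_psi acov1s M_def)
  have Q_eq: "(\<Sum>\<^sub>\<infinity>(k1, k2). acov2 ?psi (a - k1) (b - k2) * acov1 ?xi k1 * acov1 ?omega k2) = Q (a, b)" for a b
    unfolding inner Q_def ..
  have inner_summable: "(\<lambda>(k1, k2). acov2 ?psi (a - k1) (b - k2) * acov1 ?xi k1 * acov1 ?omega k2)
      summable_on UNIV" for a b
    unfolding inner
    by (rule abs_summable_summable[OF abs_summable_convolution_term[OF abs_summable_autocov[OF \<psi>] M]])

  define flip :: "int \<times> int \<Rightarrow> int \<times> int" where "flip = (\<lambda>(j1, j2). (- j1, j2))"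
  have flip: "bij flip"
    by (rule o_bij[of flip]) (auto simp: flip_def)
  \<comment> \<open>Reflecting \<open>j1\<close> turns \<open>h1 + j1\<close> into
    \<open>h1 - j1\<close>; this accounts for the unequal signs in the formula.\<close>
  have outer: "(\<lambda>(j1, j2). acov2 ?phi j1 j2 * Q (h1 + j1, h2 - j2))
      = (\<lambda>j. (\<lambda>j. Q ((h1, h2) - j) * E j) (flip j))" for h1 h2
    by (auto simp: acov_phi flip_def E_def mult.commute)
  have outer_summable: "(\<lambda>(j1, j2). acov2 ?phi j1 j2 * Q (h1 + j1, h2 - j2)) summable_on UNIV" for h1 h2
    unfolding outer summable_on_reindex_bij_betw[OF flip, of "\<lambda>j. Q ((h1, h2) - j) * E j"]
    by (rule abs_summable_summable[OF abs_summable_convolution_term[OF Q E]])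
  have R_eq: "(\<Sum>\<^sub>\<infinity>(j1, j2). acov2 ?phi j1 j2 * Q (h1 + j1, h2 - j2)) = R (h1, h2)" for h1 h2
    unfolding outer infsum_reindex_bij_betw[OF flip, of "\<lambda>j. Q ((h1, h2) - j) * E j"] R_def ..

  \<comment> \<open>The transform of \<open>R\<close> splits into the four squared moduli of the
    factorization, the skew one evaluated at \<open>inverse u\<close>.\<close>
  have "cepstral_density p \<Theta> t1 t2 = transform (char2 (exp (- \<i> * t1)) (exp (- \<i> * t2)))
      (\<lambda>h. exp (\<Theta> 0 0) * R h)" for t1 t2
  proof -
    define u v where "u = exp (- \<i> * complex_of_real t1)" and "v = exp (- \<i> * complex_of_real t2)"
    have u: "norm u = 1" and v: "norm v = 1" by (simp_all add: u_def v_def)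
    then have u': "norm (inverse u) = 1" by (simp add: norm_inverse)
    interpret unitary_character "char2 u v" by (rule unitary_character_char2[OF u v])
    interpret inv: unitary_character "char2 (inverse u) v" by (rule unitary_character_char2[OF u' v])
    interpret u: unitary_character "\<lambda>j. u powi j" by (rule unitary_character_powi[OF u])
    interpret v: unitary_character "\<lambda>j. v powi j" by (rule unitary_character_powi[OF v])
    let ?T = "transform (char2 u v)"
    have "?T R = ?T (autocov \<psi>) * ?T M * ?T E"
      unfolding R_def using transform_convolution[OF Q E]
        transform_convolution[OF abs_summable_autocov[OF \<psi>] M] by (simp add: Q_def)
    also have "?T M = transform (\<lambda>j. u powi j) (autocov ?xi) * transform (\<lambda>j. v powi j) (autocov ?omega)"
      unfolding M_def by (intro transform_tensor u v abs_summable_autocov \<xi> \<omega>)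
    also have "?T E = transform (char2 (inverse u) v) (autocov \<phi>)"
      unfolding E_def by (rule transform_flip_fst)
    finally have TR: "?T R = (?T \<psi> * cnj (?T \<psi>)) *
        (transform (\<lambda>j. u powi j) ?xi * cnj (transform (\<lambda>j. u powi j) ?xi) *
        (transform (\<lambda>j. v powi j) ?omega * cnj (transform (\<lambda>j. v powi j) ?omega))) *
        (transform (char2 (inverse u) v) \<phi> * cnj (transform (char2 (inverse u) v) \<phi>))"
      by (simp only: transform_autocov[OF \<psi>] inv.transform_autocov[OF \<phi>]
          u.transform_autocov[OF \<xi>] v.transform_autocov[OF \<omega>])
    have T\<psi>: "?T \<psi> = exp (\<Sum>k1=1..int p. \<Sum>k2=1..int p. \<Theta> k1 k2 * (u powi k1 * v powi k2))"
      unfolding \<psi>_def by (intro transform_psi_coeff u v) (simp add: assms(3))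
    have T\<phi>: "transform (char2 (inverse u) v) \<phi>
        = exp (\<Sum>k1=1..int p. \<Sum>k2=1..int p. \<Theta> (- k1) k2 * (inverse u powi k1 * v powi k2))"
      unfolding \<phi>_def phi_coeff_def by (intro transform_psi_coeff u' v) (simp add: assms(3))
    have "cepstral_density p \<Theta> t1 t2 = of_real (exp (\<Theta> 0 0)) * ?T R"
      unfolding TR T\<psi> T\<phi> xi_coeff_def omega_coeff_def transform_axis_coeff
      using exp_trig_poly_factorization[of p \<Theta> u v, OF assms(2) u v]
      by (simp only: cepstral_density_def u_def v_def)
    then show ?thesis
      by (simp add: transform_cmult u_def v_def)
  qed
  then have "cepstral_density p \<Theta> = (\<lambda>t1 t2. transform (char2 (exp (- \<i> * t1)) (exp (- \<i> * t2)))
      (\<lambda>h. exp (\<Theta> 0 0) * R h))"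
    by (simp add: fun_eq_iff)
  moreover have "(\<lambda>h. exp (\<Theta> 0 0) * R h) abs_summable_on UNIV"
    using R by (simp add: abs_mult summable_on_cmult_right)
  ultimately have "spectral_acov (cepstral_density p \<Theta>) h1 h2 = of_real (exp (\<Theta> 0 0) * R (h1, h2))" for h1 h2
    using spectral_acov_transform by simp
  then show ?thesis
    using conv by (simp only: Q_eq R_eq inner_summable outer_summable) simp
qed

end
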